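(* The following statements hold: (1) For every integer $k\geq 1$ and every integer $n\geq 3k+2$, there exists a $2(2k+1)$-eigenfunction $f$ of the hypercube $H(n,2)$ such that $\mathrm{SND}(f)=2$. (2) For every integer $k\geq 1$ and every integer $n\geq 3k+4$, there exists a $2(2k+2)$-eigenfunction $f$ of $H(n,2)$ such that $\mathrm{SND}(f)=2$.
   Context: The Hamming graph $H(n,q)$ has vertex set $\mathbb{Z}_q^n$, two vertices being adjacent iff they differ in exactly one coordinate; $H(n,2)$ is the $n$-dimensional hypercube. For a graph $G$ with vertex set $V$ and a real number $\lambda$, a $\lambda$-eigenfunction of $G$ is a function $f:V\to\mathbb{R}$ with $f\not\equiv 0$ such that $\lambda f(x)=\sum_{y\in N(x)}(f(x)-f(y))$ for every $x\in V$, where $N(x)$ is the set of neighbours of $x$ (i.e. an eigenvector of the Laplacian $D-A$). A positive (negative) strong nodal domain of $f$ is a maximal connected induced subgraph of $G$ on vertices $x$ with $f(x)>0$ ($f(x)<0$); $\mathrm{SND}(f)$ denotes the total number of strong nodal domains of $f$. *)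

theory Defs
  imports Complex_Main "HOL-Library.FuncSet" "Graph_Theory.Graph_Theory"
begin

text \<open>
  Undirected graphs are represented as symmetric digraphs. The elements of \<open>\<int>\<^sub>q\<^sup>n\<close> are the
  extensional functions from \<open>{..<n}\<close> to \<open>{..<q}\<close>; only equality of coordinates matters, so
  residues are represented by their least representatives.
\<close>

definition hamming_graph :: "nat \<Rightarrow> nat \<Rightarrow> (nat \<Rightarrow> nat) pair_pre_digraph" where
  "hamming_graph n q =
    \<lparr> pverts = {..<n} \<rightarrow>\<^sub>E {..<q},
      parcs = {(x, y). x \<in> {..<n} \<rightarrow>\<^sub>E {..<q} \<and> y \<in> {..<n} \<rightarrow>\<^sub>E {..<q} \<and>
                       card {i \<in> {..<n}. x i \<noteq> y i} = 1} \<rparr>"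

lemma pair_graph_hamming_graph: "pair_graph (hamming_graph n q)"
proof
  show fin: "finite (pverts (hamming_graph n q))"
    by (simp add: hamming_graph_def finite_PiE)
  have sub: "parcs (hamming_graph n q) \<subseteq> pverts (hamming_graph n q) \<times> pverts (hamming_graph n q)"
    unfolding hamming_graph_def by force
  show "finite (parcs (hamming_graph n q))"
    using finite_subset[OF sub] fin by simp
  show "symmetric (with_proj (hamming_graph n q))"
    unfolding symmetric_def with_proj_simps
  proof (rule symI)
    fix x y :: "nat \<Rightarrow> nat"
    have "card {i \<in> {..<n}. x i \<noteq> y i} = card {i \<in> {..<n}. y i \<noteq> x i}"
      by (simp only: eq_commute)
    then show "(x, y) \<in> parcs (hamming_graph n q) \<Longrightarrow> (y, x) \<in> parcs (hamming_graph n q)"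
      by (simp only: hamming_graph_def pair_pre_digraph.select_convs mem_Collect_eq prod.case)
  qed
  show "fst e \<in> pverts (hamming_graph n q)" "snd e \<in> pverts (hamming_graph n q)"
    if "e \<in> parcs (hamming_graph n q)" for e
    using that sub by force+
  show "fst e \<noteq> snd e" if "e \<in> parcs (hamming_graph n q)" for e
    using that by (cases e) (clarsimp simp: hamming_graph_def)
qed

definition neighbours :: "('a, 'b) pre_digraph \<Rightarrow> 'a \<Rightarrow> 'a set" where
  "neighbours G x = {y. x \<rightarrow>\<^bsub>G\<^esub> y}"

text \<open>Eigenvectors of the Laplacian \<open>D - A\<close>; only the values of \<open>f\<close> on the vertices matter.\<close>

definition eigenfunction :: "('a, 'b) pre_digraph \<Rightarrow> real \<Rightarrow> ('a \<Rightarrow> real) \<Rightarrow> bool" where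
  "eigenfunction G l f \<longleftrightarrow>
    (\<exists>x \<in> verts G. f x \<noteq> 0) \<and>
    (\<forall>x \<in> verts G. l * f x = (\<Sum>y \<in> neighbours G x. f x - f y))"

text \<open>
  The maximal connected induced subgraphs of \<open>G\<close> among those with all vertices in \<open>S\<close>. The library
  notion \<^const>\<open>Digraph_Component.connected\<close> excludes the empty graph.
\<close>

definition components_in :: "('a, 'b) pre_digraph \<Rightarrow> 'a set \<Rightarrow> ('a, 'b) pre_digraph set" where
  "components_in G S =
    {H. induced_subgraph H G \<and> Digraph_Component.connected H \<and> verts H \<subseteq> S \<and>
        \<not> (\<exists>H'. induced_subgraph H' G \<and> Digraph_Component.connected H' \<and> verts H' \<subseteq> S \<and>
                verts H \<subset> verts H')}"

definition positive_strong_nodal_domains ::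
  "('a, 'b) pre_digraph \<Rightarrow> ('a \<Rightarrow> real) \<Rightarrow> ('a, 'b) pre_digraph set" where
  "positive_strong_nodal_domains G f = components_in G {x. f x > 0}"

definition negative_strong_nodal_domains ::
  "('a, 'b) pre_digraph \<Rightarrow> ('a \<Rightarrow> real) \<Rightarrow> ('a, 'b) pre_digraph set" where
  "negative_strong_nodal_domains G f = components_in G {x. f x < 0}"

definition SND :: "('a, 'b) pre_digraph \<Rightarrow> ('a \<Rightarrow> real) \<Rightarrow> nat" where
  "SND G f = card (positive_strong_nodal_domains G f \<union> negative_strong_nodal_domains G f)"

end

theory Submission
  imports Defs
begin

text \<open>
  A nowhere vanishing \<open>f\<close> of level \<open>m\<close> (eigenvalue \<open>2m\<close>) on the \<open>n\<close>-cube whose two sign classes are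
  connected is lifted to more coordinates by gluing it to a character \<open>g\<close>. Writing
  \<open>s, t, u = \<plusminus>1\<close> for the signs of new coordinates, \<open>s f\<close> on \<open>s = t\<close> and \<open>s g\<close> on \<open>s \<noteq> t\<close> has level
  \<open>m + 1\<close> if \<open>g\<close> has level \<open>m\<close>; with \<open>s u f\<close> in place of \<open>s f\<close> the level is \<open>m + 2\<close> if \<open>g\<close> has level
  \<open>m + 1\<close>. Choosing \<open>g\<close> positive at both ends of an edge on which \<open>f\<close> changes sign, the copies of
  the sign classes of \<open>f\<close> get joined through that edge in the layer \<open>s \<noteq> t\<close>, and every other point
  of that layer is adjacent to a point of the same sign in a layer \<open>s = t\<close>. Hence
  \<open>(n, m)\<close> leads to \<open>(n + 2, m + 1)\<close> and \<open>(n + 3, m + 2)\<close>, and the induction starts from an explicit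
  function of level 3 on the 5-cube.
\<close>

section \<open>Sign connectivity on the cube\<close>

definition flip :: "nat \<Rightarrow> (nat \<Rightarrow> bool) \<Rightarrow> nat \<Rightarrow> bool" where
  "flip i x = x(i := \<not> x i)"

definition sg :: "bool \<Rightarrow> real" where
  "sg b = (if b then -1 else 1)"

text \<open>
  Points of all cubes share one type: functions on the \<open>n\<close>-cube are functions of infinitely many
  bits that ignore the bits from \<open>n\<close> on.
\<close>

definition cube :: "nat \<Rightarrow> (nat \<Rightarrow> bool) set" where
  "cube n = {x. \<forall>i\<ge>n. \<not> x i}"

definition depends_below :: "nat \<Rightarrow> ((nat \<Rightarrow> bool) \<Rightarrow> real) \<Rightarrow> bool" where
  "depends_below n f \<longleftrightarrow> (\<forall>x y. (\<forall>i<n. x i = y i) \<longrightarrow> f x = f y)"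

definition laplace :: "nat \<Rightarrow> nat \<Rightarrow> ((nat \<Rightarrow> bool) \<Rightarrow> real) \<Rightarrow> bool" where
  "laplace n m f \<longleftrightarrow> (\<forall>x. (\<Sum>i<n. f x - f (flip i x)) = 2 * real m * f x)"

text \<open>The flipped bit is not bounded by a dimension, so \<open>linked\<close> refers to none.
  Flips of bits that \<open>f\<close> ignores become moves that keep the value.\<close>

definition pos_step :: "((nat \<Rightarrow> bool) \<Rightarrow> real) \<Rightarrow> (nat \<Rightarrow> bool) \<Rightarrow> (nat \<Rightarrow> bool) \<Rightarrow> bool" where
  "pos_step f x y \<longleftrightarrow> 0 < f x \<and> 0 < f y \<and> (\<exists>i. y = flip i x)"

abbreviation linked :: "((nat \<Rightarrow> bool) \<Rightarrow> real) \<Rightarrow> (nat \<Rightarrow> bool) \<Rightarrow> (nat \<Rightarrow> bool) \<Rightarrow> bool" where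
  "linked f \<equiv> (pos_step f)\<^sup>*\<^sup>*"

definition pos_connected :: "nat \<Rightarrow> ((nat \<Rightarrow> bool) \<Rightarrow> real) \<Rightarrow> bool" where
  "pos_connected n f \<longleftrightarrow>
    (\<forall>x \<in> cube n. \<forall>y \<in> cube n. 0 < f x \<longrightarrow> 0 < f y \<longrightarrow> linked f x y)"

lemma flip_flip [simp]: "flip i (flip i x) = x"
  by (simp add: flip_def)

lemma sg_simps [simp]: "sg True = -1" "sg False = 1" "sg (\<not> b) = - sg b" "sg b * (sg b * r) = r"
  by (simp_all add: sg_def)

lemma sg_neq_0 [simp]: "sg b \<noteq> 0"
  by (simp add: sg_def)

lemma flip_in_cube: "x \<in> cube n \<Longrightarrow> i < n \<Longrightarrow> flip i x \<in> cube n"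
  by (auto simp: cube_def flip_def)

lemma depends_belowD: "depends_below n f \<Longrightarrow> n \<le> i \<Longrightarrow> f (x(i := b)) = f x"
  by (simp add: depends_below_def)

lemma depends_below_uminus: "depends_below n f \<Longrightarrow> depends_below n (\<lambda>x. - f x)"
  by (simp add: depends_below_def)

lemma depends_below_mono: "depends_below n f \<Longrightarrow> n \<le> k \<Longrightarrow> depends_below k f"
  unfolding depends_below_def by (blast intro: less_le_trans)

lemma depends_below_flip: "depends_below n f \<Longrightarrow> n \<le> i \<Longrightarrow> f (flip i x) = f x"
  by (simp add: flip_def depends_belowD)

lemma linked_sym: "linked f x y \<Longrightarrow> linked f y x"
proof -
  have "symp (pos_step f)"
    by (rule sympI) (metis flip_flip pos_step_def)
  then show "linked f x y \<Longrightarrow> linked f y x"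
    by (metis symp_rtranclp sympD)
qed

lemma linked_trans [trans]: "linked f x y \<Longrightarrow> linked f y z \<Longrightarrow> linked f x z"
  by (rule rtranclp_trans)

lemma linked_flip: "0 < f x \<Longrightarrow> 0 < f (flip i x) \<Longrightarrow> linked f x (flip i x)"
  by (rule r_into_rtranclp) (auto simp: pos_step_def)

lemma linked_update: "0 < f x \<Longrightarrow> 0 < f (x(i := b)) \<Longrightarrow> linked f x (x(i := b))"
  using linked_flip[of f x i] by (cases "x i = b") (auto simp: flip_def fun_upd_idem)

lemma pos_connectedI:
  assumes "\<And>x. x \<in> cube n \<Longrightarrow> 0 < f x \<Longrightarrow> linked f x z"
  shows "pos_connected n f"
  unfolding pos_connected_def using assms by (blast intro: linked_trans linked_sym)

lemma linked_flip_or_eq: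
  assumes "0 < f x" "0 < f y" "y = x \<or> y = flip i x"
  shows "linked f x y"
  using assms linked_flip by blast

text \<open>\<open>\<psi>\<close> may collapse edges because the embeddings of a cube as a layer of
  a larger one overwrite the new bits: a flip of such a bit is lost.\<close>

lemma linked_map:
  assumes pos: "\<And>z. 0 < f z \<Longrightarrow> 0 < F (\<psi> z)"
    and flip: "\<And>i z. \<psi> (flip i z) = \<psi> z \<or> \<psi> (flip i z) = flip i (\<psi> z)"
    and "linked f x y"
  shows "linked F (\<psi> x) (\<psi> y)"
  using \<open>linked f x y\<close>
proof (induction rule: rtranclp_induct)
  case (step y z)
  then obtain i where z: "z = flip i y" and "0 < f y" "0 < f z"
    by (auto simp: pos_step_def)
  with pos have "0 < F (\<psi> y)" "0 < F (\<psi> z)"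
    by auto
  with flip[of i y] z have "linked F (\<psi> y) (\<psi> z)"
    by (auto intro: linked_flip_or_eq)
  with step.IH show ?case
    by (rule linked_trans)
qed simp

text \<open>The last clause provides the edge along which functions are glued. It also ensures that
  both signs occur, which \<open>pos_connected\<close> alone does not.\<close>

definition two_domain :: "nat \<Rightarrow> nat \<Rightarrow> ((nat \<Rightarrow> bool) \<Rightarrow> real) \<Rightarrow> bool" where
  "two_domain n m f \<longleftrightarrow> depends_below n f \<and> (\<forall>x. f x \<noteq> 0) \<and> laplace n m f \<and>
    pos_connected n f \<and> pos_connected n (\<lambda>x. - f x) \<and>
    (\<exists>x \<in> cube n. \<exists>i<n. 0 < f x \<and> f (flip i x) < 0)"

section \<open>Increasing the dimension\<close>

lemma cube_update:
  assumes "x \<in> cube (Suc n)"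
  shows "x(n := False) \<in> cube n"
  using assms by (auto simp: cube_def)

text \<open>Clearing bit \<open>n\<close> keeps the value of \<open>f\<close>, so any positive point
  can move back into \<open>cube n\<close>.\<close>

lemma pos_connected_Suc:
  assumes dep: "depends_below n f" and con: "pos_connected n f"
  shows "pos_connected (Suc n) f"
  unfolding pos_connected_def
proof (intro ballI impI)
  fix x y assume x: "x \<in> cube (Suc n)" "0 < f x" and y: "y \<in> cube (Suc n)" "0 < f y"
  have upd: "f (z(n := False)) = f z" for z
    using dep by (simp add: depends_belowD)
  have "linked f x (x(n := False))"
    using x by (intro linked_update) (simp_all add: upd)
  also have "linked f (x(n := False)) (y(n := False))"
    using con x y by (simp add: pos_connected_def cube_update upd)
  also have "linked f (y(n := False)) y"
    using y by (intro linked_sym[OF linked_update]) (simp_all add: upd)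
  finally show "linked f x y" .
qed

text \<open>The new bit contributes zero to the Laplacian, so the level stays the same. This reaches
  every dimension above the minimal one.\<close>

lemma two_domain_Suc:
  assumes "two_domain n m f"
  shows "two_domain (Suc n) m f"
proof -
  from assms have dep: "depends_below n f" and "laplace n m f"
    and con: "pos_connected n f" "pos_connected n (\<lambda>x. - f x)"
    by (auto simp: two_domain_def)
  then have "laplace (Suc n) m f"
    by (simp add: laplace_def depends_below_flip)
  moreover have "pos_connected (Suc n) f" "pos_connected (Suc n) (\<lambda>x. - f x)"
    by (rule pos_connected_Suc[OF dep con(1)],
        rule pos_connected_Suc[OF depends_below_uminus[OF dep] con(2)])
  moreover have "cube n \<subseteq> cube (Suc n)"
    by (auto simp: cube_def)
  moreover have "depends_below (Suc n) f"
    using dep by (rule depends_below_mono) simp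
  ultimately show ?thesis
    using assms unfolding two_domain_def by (meson less_SucI subsetD)
qed

lemma two_domain_mono: "n \<le> n' \<Longrightarrow> two_domain n m f \<Longrightarrow> two_domain n' m f"
  by (induction rule: dec_induct) (auto intro: two_domain_Suc)

section \<open>Characters\<close>

text \<open>Flipping a bit in \<open>S\<close> negates the product and flipping any other bit
  preserves it, so each element of \<open>S\<close> contributes twice the value. The base point
  \<open>x0\<close> only fixes the overall sign.\<close>

lemma laplace_character:
  fixes x0 :: "nat \<Rightarrow> bool"
  assumes "S \<subseteq> {..<n}"
  shows "laplace n (card S) (\<lambda>x. \<Prod>j\<in>S. sg (x j \<noteq> x0 j))"
  unfolding laplace_def
proof
  fix x
  let ?\<chi> = "\<lambda>x. \<Prod>j\<in>S. sg (x j \<noteq> x0 j)"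
  have fin: "finite S"
    using assms finite_subset by blast
  have eq: "?\<chi> x - ?\<chi> (flip i x) = (if i \<in> S then 2 * ?\<chi> x else 0)" for i
  proof (cases "i \<in> S")
    case True
    have "?\<chi> (flip i x) = sg (flip i x i \<noteq> x0 i) * (\<Prod>j\<in>S - {i}. sg (flip i x j \<noteq> x0 j))"
      using True fin by (rule prod.remove[rotated])
    also have "(\<Prod>j\<in>S - {i}. sg (flip i x j \<noteq> x0 j)) = (\<Prod>j\<in>S - {i}. sg (x j \<noteq> x0 j))"
      by (rule prod.cong) (auto simp: flip_def)
    also have "sg (flip i x i \<noteq> x0 i) = - sg (x i \<noteq> x0 i)"
      by (auto simp: flip_def sg_def)
    also have "- sg (x i \<noteq> x0 i) * (\<Prod>j\<in>S - {i}. sg (x j \<noteq> x0 j)) = - ?\<chi> x"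
      using prod.remove[OF fin True, of "\<lambda>j. sg (x j \<noteq> x0 j)"] by simp
    finally show ?thesis
      using True by simp
  next
    case False
    then have "?\<chi> (flip i x) = ?\<chi> x"
      by (intro prod.cong) (auto simp: flip_def)
    with False show ?thesis
      by simp
  qed
  have "(\<Sum>i<n. ?\<chi> x - ?\<chi> (flip i x)) = (\<Sum>i\<in>{..<n} \<inter> S. 2 * ?\<chi> x)"
    by (simp only: eq sum.inter_restrict[OF finite_lessThan])
  also have "{..<n} \<inter> S = S"
    using assms by blast
  finally show "(\<Sum>i<n. ?\<chi> x - ?\<chi> (flip i x)) = 2 * real (card S) * ?\<chi> x"
    by simp
qed

text \<open>A set \<open>S\<close> avoiding \<open>i\<close> makes the character constant along the
  edge, and basing it at \<open>x\<close> makes that constant 1. The other \<open>n - 1\<close> bits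
  suffice since \<open>r < n\<close>.\<close>

lemma character_exists:
  assumes "i < n" and "r < n"
  obtains g where "depends_below n g" "\<And>x. g x \<noteq> 0" "laplace n r g"
    "0 < g x" "0 < g (flip i x)"
proof -
  have "r \<le> card ({..<n} - {i})"
    using assms by simp
  then obtain S where S: "S \<subseteq> {..<n} - {i}" "card S = r"
    by (meson obtain_subset_with_card_n)
  have fin: "finite S"
    using S finite_subset by blast
  let ?g = "\<lambda>y. \<Prod>j\<in>S. sg (y j \<noteq> x j)"
  show thesis
  proof (rule that)
    show "depends_below n ?g"
      unfolding depends_below_def
    proof (intro allI impI prod.cong refl)
      fix y z :: "nat \<Rightarrow> bool" and j assume "\<forall>k<n. y k = z k" "j \<in> S"
      with S(1) have "y j = z j"
        by blast
      then show "sg (y j \<noteq> x j) = sg (z j \<noteq> x j)"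
        by simp
    qed
    show "?g y \<noteq> 0" for y
      using fin by simp
    show "laplace n r ?g"
      using S laplace_character[of S n x] by blast
    show "0 < ?g x"
      by simp
    have "?g (flip i x) = 1"
      using S by (intro prod.neutral) (auto simp: flip_def)
    then show "0 < ?g (flip i x)"
      by simp
  qed
qed

section \<open>Two more coordinates, one more level\<close>

text \<open>The positions \<open>p\<close> and \<open>q\<close> are parameters because negation
  exchanges them. Connectivity, proved for both orders, then serves the glued function and its
  negative alike.\<close>

definition extend2 ::
  "nat \<Rightarrow> nat \<Rightarrow> ((nat \<Rightarrow> bool) \<Rightarrow> real) \<Rightarrow> ((nat \<Rightarrow> bool) \<Rightarrow> real) \<Rightarrow> (nat \<Rightarrow> bool) \<Rightarrow> real" where
  "extend2 p q f g x = sg (x p) * (if x p = x q then f x else g x)"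

lemma depends_below_extend2:
  assumes "depends_below n f" "depends_below n g" "n \<le> k" "p < k" "q < k"
  shows "depends_below k (extend2 p q f g)"
  unfolding depends_below_def
proof (intro allI impI)
  fix x y :: "nat \<Rightarrow> bool" assume eq: "\<forall>i<k. x i = y i"
  with \<open>n \<le> k\<close> have "\<forall>i<n. x i = y i"
    using less_le_trans by blast
  with assms(1,2) have "f x = f y" "g x = g y"
    unfolding depends_below_def by blast+
  moreover have "x p = y p" "x q = y q"
    using eq assms by blast+
  ultimately show "extend2 p q f g x = extend2 p q f g y"
    by (simp add: extend2_def)
qed

lemma laplace_extend2:
  assumes dep: "depends_below n f" "depends_below n g" and lap: "laplace n m f" "laplace n m g"
  shows "laplace (n + 2) (m + 1) (extend2 n (n + 1) f g)"
  unfolding laplace_def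
proof
  fix x
  let ?F = "extend2 n (n + 1) f g"
  have below: "?F x - ?F (flip i x) =
      sg (x n) * (if x n = x (n + 1) then f x - f (flip i x) else g x - g (flip i x))"
    if "i < n" for i
    using that by (simp add: extend2_def flip_def algebra_simps)
  have "(\<Sum>i<n. ?F x - ?F (flip i x)) = (\<Sum>i<n. sg (x n) *
      (if x n = x (n + 1) then f x - f (flip i x) else g x - g (flip i x)))"
    by (rule sum.cong) (simp_all only: below lessThan_iff)
  also have "\<dots> = 2 * real m * ?F x"
    using lap by (simp add: extend2_def laplace_def sum_distrib_left[symmetric])
  finally have "(\<Sum>i<n. ?F x - ?F (flip i x)) = 2 * real m * ?F x" .
  \<comment> \<open>The neighbours along the two new bits have opposite values, so they cancel and
    \<open>2 * ?F x\<close> remains: one more level.\<close>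
  moreover have "(?F x - ?F (flip n x)) + (?F x - ?F (flip (n + 1) x)) = 2 * ?F x"
    using dep by (cases "x n"; cases "x (n + 1)")
      (simp_all add: extend2_def flip_def depends_belowD)
  moreover have "{..<n + 2} = insert (n + 1) (insert n {..<n})"
    by auto
  ultimately show "(\<Sum>i<n + 2. ?F x - ?F (flip i x)) = 2 * real (m + 1) * ?F x"
    by (simp add: algebra_simps)
qed

lemma pos_connected_extend2:
  assumes dep: "depends_below n f" "depends_below n g"
    and pq: "p = n \<and> q = n + 1 \<or> p = n + 1 \<and> q = n"
    and con: "pos_connected n f" "pos_connected n (\<lambda>x. - f x)"
    and x0: "x0 \<in> cube n" "0 < f x0" "0 < g x0"
    and x1: "x1 \<in> cube n" "f x1 < 0" "0 < g x1" "x1 = flip i x0" "i < n"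
    and nz: "\<And>x. f x \<noteq> 0"
  shows "pos_connected (n + 2) (extend2 p q f g)"
proof -
  let ?F = "extend2 p q f g"
  define \<psi> where "\<psi> a b x = x(p := a, q := b)" for a b and x :: "nat \<Rightarrow> bool"
  have ne: "p \<noteq> q" "n \<le> p" "n \<le> q"
    using pq by auto
  have F: "?F (\<psi> a b x) = sg a * (if a = b then f x else g x)" for a b x
    using ne dep by (simp add: extend2_def \<psi>_def depends_belowD)
  have \<psi>_flip: "\<psi> a b (flip i z) = \<psi> a b z \<or> \<psi> a b (flip i z) = flip i (\<psi> a b z)" for a b i z
    by (auto simp: \<psi>_def flip_def fun_eq_iff)
  have \<psi>_upd: "\<psi> a b z = (\<psi> a b' z)(q := b)" "\<psi> a b z = (\<psi> a' b z)(p := a)" for a a' b b' z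
    using ne by (auto simp: \<psi>_def fun_eq_iff)
  have up: "linked ?F (\<psi> a b z) (\<psi> a b' z)" if "0 < ?F (\<psi> a b z)" "0 < ?F (\<psi> a b' z)" for a b b' z
    using that \<psi>_upd(1)[of a b' z b] linked_update by metis
  have up': "linked ?F (\<psi> a b z) (\<psi> a' b z)" if "0 < ?F (\<psi> a b z)" "0 < ?F (\<psi> a' b z)" for a a' b z
    using that \<psi>_upd(2)[of a' b z a] linked_update by metis
  \<comment> \<open>For \<open>(a, b)\<close> equal to \<open>(False, False)\<close>,
    \<open>(True, True)\<close>, \<open>(False, True)\<close>, \<open>(True, False)\<close> the
    layer carries \<open>f\<close>, \<open>-f\<close>, \<open>g\<close>, \<open>-g\<close>. The edge
    from \<open>x0\<close> to \<open>x1\<close> is crossed in the layer of \<open>g\<close>, and its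
    end over \<open>x0\<close> is the hub.\<close>
  let ?P = "\<psi> False True x0"
  have P0: "linked ?F (\<psi> False False x0) ?P"
    using x0 by (intro up) (simp_all add: F)
  have "linked ?F ?P (\<psi> False True x1)"
    using x0 x1 \<psi>_flip[of False True i x0] by (intro linked_flip_or_eq) (simp_all add: F)
  moreover have "linked ?F (\<psi> False True x1) (\<psi> True True x1)"
    using x1 by (intro up') (simp_all add: F)
  ultimately have P1: "linked ?F (\<psi> True True x1) ?P"
    by (meson linked_sym linked_trans)
  have diag: "linked ?F (\<psi> a a x) ?P" if x: "x \<in> cube n" "0 < ?F (\<psi> a a x)" for a x
  proof (cases a)
    case True
    with x have "0 < - f x"
      by (simp add: F)
    with con x x1 have "linked (\<lambda>x. - f x) x x1"
      by (simp add: pos_connected_def)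
    then have "linked ?F (\<psi> a a x) (\<psi> a a x1)"
      by (rule linked_map[rotated 2]) (use True \<psi>_flip in \<open>auto simp: F\<close>)
    with True P1 show ?thesis
      by (auto intro: linked_trans)
  next
    case False
    with x have "0 < f x"
      by (simp add: F)
    with con x x0 have "linked f x x0"
      by (simp add: pos_connected_def)
    then have "linked ?F (\<psi> a a x) (\<psi> a a x0)"
      by (rule linked_map[rotated 2]) (use False \<psi>_flip in \<open>auto simp: F\<close>)
    with False P0 show ?thesis
      by (auto intro: linked_trans)
  qed
  have all: "linked ?F (\<psi> a b x) ?P" if x: "x \<in> cube n" "0 < ?F (\<psi> a b x)" for a b x
  proof (cases "a = b")
    case True
    with x diag show ?thesis by simp
  next
    case False
    \<comment> \<open>The neighbours in the two layers with equal bits carry \<open>f x\<close> and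
      \<open>- f x\<close>, one of which is positive.\<close>
    have "0 < ?F (\<psi> a a x) \<or> 0 < ?F (\<psi> b b x)"
      using False nz[of x] by (cases a; cases b) (auto simp: F)
    then show ?thesis
      using x diag up[of a b x a] up'[of a b x b] by (blast intro: linked_trans)
  qed
  show ?thesis
  proof (rule pos_connectedI)
    fix x assume "x \<in> cube (n + 2)" "0 < ?F x"
    moreover from this pq have "x(p := False, q := False) \<in> cube n"
      by (auto simp: cube_def)
    moreover have "\<psi> (x p) (x q) (x(p := False, q := False)) = x"
      by (simp add: \<psi>_def fun_eq_iff)
    ultimately show "linked ?F x ?P"
      using all by metis
  qed
qed

text \<open>Where the two bits differ, \<open>sg (x p) = - sg (x q)\<close>; where they agree, the
  minus sign goes into \<open>f\<close>.\<close>

lemma minus_extend2: "p \<noteq> q \<Longrightarrow> - extend2 p q f g x = extend2 q p (\<lambda>x. - f x) g x"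
  by (cases "x p"; cases "x q") (simp_all add: extend2_def)

lemma two_domain_extend2:
  assumes f: "two_domain n m f" and mn: "m < n"
  shows "\<exists>F. two_domain (n + 2) (m + 1) F"
proof -
  from f obtain x0 i where x0: "x0 \<in> cube n" "i < n" "0 < f x0" "f (flip i x0) < 0"
    by (auto simp: two_domain_def)
  from f have dep: "depends_below n f" and nz: "\<And>x. f x \<noteq> 0" and lap: "laplace n m f"
    and con: "pos_connected n f" "pos_connected n (\<lambda>x. - f x)"
    by (auto simp: two_domain_def)
  obtain g where g: "depends_below n g" "\<And>x. g x \<noteq> 0" "laplace n m g"
    "0 < g x0" "0 < g (flip i x0)"
    using character_exists[OF x0(2) mn] by blast
  have ndep: "depends_below n (\<lambda>x. - f x)"
    using dep by (rule depends_below_uminus)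
  define F where "F = extend2 n (n + 1) f g"
  \<comment> \<open>For \<open>-f\<close> the sign changes the other way along the edge, so its ends
    are exchanged.\<close>
  have "pos_connected (n + 2) (extend2 (n + 1) n (\<lambda>x. - f x) g)"
    using x0 g con dep nz
    by (intro pos_connected_extend2[of _ _ _ _ _ "flip i x0" x0 i]) (auto simp: ndep flip_in_cube)
  then have "pos_connected (n + 2) (\<lambda>x. - F x)"
    by (simp add: F_def minus_extend2 cong: if_cong)
  moreover have "pos_connected (n + 2) F"
    unfolding F_def using x0 g con dep nz
    by (intro pos_connected_extend2[of _ _ _ _ _ x0 "flip i x0" i]) (auto simp: flip_in_cube)
  \<comment> \<open>\<open>F\<close> is \<open>f\<close> where both new bits are clear, so the edge
    with the sign change survives for the next gluing.\<close>
  moreover have "x0 \<in> cube (n + 2)" "F x0 = f x0" "F (flip i x0) = f (flip i x0)"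
    using x0 by (auto simp: F_def extend2_def cube_def flip_def)
  moreover have "depends_below (n + 2) F"
    unfolding F_def using dep g by (auto intro: depends_below_extend2)
  moreover have "laplace (n + 2) (m + 1) F"
    unfolding F_def by (rule laplace_extend2[OF dep g(1) lap g(3)])
  moreover have "F x \<noteq> 0" for x
    using nz g by (simp add: F_def extend2_def)
  ultimately show ?thesis
    using x0 unfolding two_domain_def by (metis trans_less_add1)
qed

section \<open>Three more coordinates, two more levels\<close>

text \<open>This is \<open>extend2 p q\<close> with \<open>sg (x a) * f x\<close> in place of
  \<open>f\<close>. If \<open>f\<close> ignores bit \<open>a\<close> and takes both signs, each sign
  class of that product falls into parts, one for each value of bit \<open>a\<close>, with no edge
  between them. Connectivity therefore needs a separate argument.\<close>

definition extend3 ::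
  "nat \<Rightarrow> nat \<Rightarrow> nat \<Rightarrow> ((nat \<Rightarrow> bool) \<Rightarrow> real) \<Rightarrow> ((nat \<Rightarrow> bool) \<Rightarrow> real) \<Rightarrow> (nat \<Rightarrow> bool) \<Rightarrow> real" where
  "extend3 a p q f g x = sg (x p) * (if x p = x q then sg (x a) * f x else g x)"

lemma depends_below_extend3:
  assumes "depends_below n f" "depends_below n g" "n \<le> k" "a < k" "p < k" "q < k"
  shows "depends_below k (extend3 a p q f g)"
  unfolding depends_below_def
proof (intro allI impI)
  fix x y :: "nat \<Rightarrow> bool" assume eq: "\<forall>i<k. x i = y i"
  with \<open>n \<le> k\<close> have "\<forall>i<n. x i = y i"
    using less_le_trans by blast
  with assms(1,2) have "f x = f y" "g x = g y"
    unfolding depends_below_def by blast+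
  moreover have "x a = y a" "x p = y p" "x q = y q"
    using eq assms by blast+
  ultimately show "extend3 a p q f g x = extend3 a p q f g y"
    by (simp add: extend3_def)
qed

lemma laplace_extend3:
  assumes dep: "depends_below n f" "depends_below n g" and lap: "laplace n m f" "laplace n (m + 1) g"
  shows "laplace (n + 3) (m + 2) (extend3 n (n + 1) (n + 2) f g)"
  unfolding laplace_def
proof
  fix x
  let ?F = "extend3 n (n + 1) (n + 2) f g"
  have below: "?F x - ?F (flip i x) = sg (x (n + 1)) * (if x (n + 1) = x (n + 2)
      then sg (x n) * (f x - f (flip i x)) else g x - g (flip i x))"
    if "i < n" for i
    using that by (simp add: extend3_def flip_def algebra_simps)
  have "(\<Sum>i<n. ?F x - ?F (flip i x)) = (\<Sum>i<n. sg (x (n + 1)) * (if x (n + 1) = x (n + 2)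
      then sg (x n) * (f x - f (flip i x)) else g x - g (flip i x)))"
    by (rule sum.cong) (simp_all only: below lessThan_iff)
  also have "\<dots> =
      (if x (n + 1) = x (n + 2) then 2 * real m * ?F x else 2 * real (m + 1) * ?F x)"
    using lap by (simp add: extend3_def laplace_def sum_distrib_left[symmetric])
  finally have "(\<Sum>i<n. ?F x - ?F (flip i x)) =
      (if x (n + 1) = x (n + 2) then 2 * real m * ?F x else 2 * real (m + 1) * ?F x)" .
  \<comment> \<open>The flips of bits \<open>n + 1\<close> and \<open>n + 2\<close> add
    \<open>2 * ?F x\<close> in all cases. The flip of bit \<open>n\<close> adds as much again where
    \<open>f\<close> is used, and nothing where \<open>g\<close> is, which offsets the different
    levels of \<open>f\<close> and \<open>g\<close>.\<close>
  moreover have "(?F x - ?F (flip n x)) + (?F x - ?F (flip (n + 1) x)) + (?F x - ?F (flip (n + 2) x))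
      = (if x (n + 1) = x (n + 2) then 4 * ?F x else 2 * ?F x)"
    using dep by (cases "x n"; cases "x (n + 1)"; cases "x (n + 2)")
      (simp_all add: extend3_def flip_def depends_belowD)
  moreover have "{..<n + 3} = insert (n + 2) (insert (n + 1) (insert n {..<n}))"
    by auto
  ultimately show "(\<Sum>i<n + 3. ?F x - ?F (flip i x)) = 2 * real (m + 2) * ?F x"
    by (simp add: algebra_simps split: if_splits)
qed

text \<open>Flipping bit \<open>n\<close> changes the sign where bits \<open>p\<close> and
  \<open>q\<close> agree and keeps the value where they differ. The layers of the second kind thus
  join the four layers of the first kind.\<close>

lemma pos_connected_extend3:
  assumes dep: "depends_below n f" "depends_below n g"
    and pq: "p = n + 1 \<and> q = n + 2 \<or> p = n + 2 \<and> q = n + 1"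
    and con: "pos_connected n f" "pos_connected n (\<lambda>x. - f x)"
    and x0: "x0 \<in> cube n" "0 < f x0" "0 < g x0"
    and x1: "x1 \<in> cube n" "f x1 < 0" "0 < g x1" "x1 = flip i x0" "i < n"
    and nz: "\<And>x. f x \<noteq> 0"
  shows "pos_connected (n + 3) (extend3 n p q f g)"
proof -
  let ?F = "extend3 n p q f g"
  define \<psi> where "\<psi> c a b x = x(n := c, p := a, q := b)" for c a b and x :: "nat \<Rightarrow> bool"
  have ne: "p \<noteq> q" "n < p" "n < q"
    using pq by auto
  have F: "?F (\<psi> c a b x) = sg a * (if a = b then sg c * f x else g x)" for c a b x
    using ne dep by (simp add: extend3_def \<psi>_def depends_belowD)
  have \<psi>_flip: "\<psi> c a b (flip i z) = \<psi> c a b z \<or> \<psi> c a b (flip i z) = flip i (\<psi> c a b z)"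
    for c a b i z
    by (auto simp: \<psi>_def flip_def fun_eq_iff)
  have upd: "linked ?F (\<psi> c a b z) (\<psi> c' a' b' z)"
    if "0 < ?F (\<psi> c a b z)" "0 < ?F (\<psi> c' a' b' z)"
      "c = c' \<and> a = a' \<or> c = c' \<and> b = b' \<or> a = a' \<and> b = b'" for c a b c' a' b' z
  proof -
    have "\<psi> c' a' b' z = (\<psi> c a b z)(q := b') \<or> \<psi> c' a' b' z = (\<psi> c a b z)(p := a') \<or>
        \<psi> c' a' b' z = (\<psi> c a b z)(n := c')"
      using that(3) ne by (auto simp: \<psi>_def fun_eq_iff)
    with that(1,2) show ?thesis
      by (metis linked_update)
  qed
  \<comment> \<open>A layer with \<open>a = b\<close> carries \<open>f\<close> if
    \<open>c = a\<close> and \<open>-f\<close> otherwise. Its positive points are led to the copy of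
    \<open>x0\<close> in the first case and of \<open>x1\<close> in the second.\<close>
  let ?P = "\<psi> False False True x0" and ?Q = "\<psi> False False True x1"
  have PQ: "linked ?F ?Q ?P"
    using x0 x1 \<psi>_flip[of False False True i x0]
    by (intro linked_sym[OF linked_flip_or_eq]) (simp_all add: F)
  have P: "linked ?F (\<psi> c c c x0) ?P" for c
  proof (cases c)
    case True
    \<comment> \<open>Clearing bit \<open>n\<close> at once would make the value negative, so bit
      \<open>p\<close> is cleared first.\<close>
    have "linked ?F (\<psi> True True True x0) (\<psi> True False True x0)"
      using x0 by (intro upd) (simp_all add: F)
    also have "linked ?F (\<psi> True False True x0) ?P"
      using x0 by (intro upd) (simp_all add: F)
    finally show ?thesis
      using True by simp
  qed (use x0 in \<open>auto simp: F intro: upd\<close>)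
  have Q: "linked ?F (\<psi> (\<not> c) c c x1) ?Q" for c
  proof (cases c)
    case False
    have "linked ?F (\<psi> True False False x1) (\<psi> True False True x1)"
      using x1 by (intro upd) (simp_all add: F)
    also have "linked ?F (\<psi> True False True x1) ?Q"
      using x1 by (intro upd) (simp_all add: F)
    finally show ?thesis
      using False by simp
  qed (use x1 in \<open>auto simp: F intro: upd\<close>)
  have diag: "linked ?F (\<psi> c a a x) ?P" if x: "x \<in> cube n" "0 < ?F (\<psi> c a a x)" for c a x
  proof (cases "c = a")
    case True
    with x have "0 < f x"
      by (cases a) (simp_all add: F)
    with con x x0 have "linked f x x0"
      by (simp add: pos_connected_def)
    then have "linked ?F (\<psi> c a a x) (\<psi> c a a x0)"
      by (rule linked_map[rotated 2]) (use True \<psi>_flip in \<open>auto simp: F\<close>)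
    with True P show ?thesis
      by (auto intro: linked_trans)
  next
    case False
    then have c: "c = (\<not> a)"
      by simp
    with x have "0 < - f x"
      by (cases a) (simp_all add: F)
    with con x x1 have "linked (\<lambda>x. - f x) x x1"
      by (simp add: pos_connected_def)
    then have "linked ?F (\<psi> c a a x) (\<psi> c a a x1)"
      by (rule linked_map[rotated 2]) (use c \<psi>_flip in \<open>auto simp: F\<close>)
    with c Q PQ show ?thesis
      by (blast intro: linked_trans)
  qed
  have all: "linked ?F (\<psi> c a b x) ?P" if x: "x \<in> cube n" "0 < ?F (\<psi> c a b x)" for c a b x
  proof (cases "a = b")
    case True
    with x diag show ?thesis by simp
  next
    case False
    have "0 < ?F (\<psi> c a a x) \<or> 0 < ?F (\<psi> c b b x)"
      using False nz[of x] by (cases a; cases b; cases c) (auto simp: F)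
    then show ?thesis
      using x diag upd[of c a b x c a a] upd[of c a b x c b b] by (blast intro: linked_trans)
  qed
  show ?thesis
  proof (rule pos_connectedI)
    fix x assume x: "x \<in> cube (n + 3)" "0 < ?F x"
    let ?x = "x(n := False, p := False, q := False)"
    have "?x \<in> cube n"
      unfolding cube_def
    proof (intro CollectI allI impI)
      fix j assume "n \<le> j"
      then consider "j = n" | "j = n + 1" | "j = n + 2" | "n + 3 \<le> j"
        by linarith
      then show "\<not> ?x j"
        using x pq by cases (auto simp: cube_def)
    qed
    moreover have "\<psi> (x n) (x p) (x q) ?x = x"
      using ne by (simp add: \<psi>_def fun_eq_iff)
    ultimately show "linked ?F x ?P"
      using all x by metis
  qed
qed

lemma minus_extend3: "p \<noteq> q \<Longrightarrow> - extend3 a p q f g x = extend3 a q p (\<lambda>x. - f x) g x"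
  by (cases "x p"; cases "x q") (simp_all add: extend3_def)

lemma two_domain_extend3:
  assumes f: "two_domain n m f" and mn: "m + 1 < n"
  shows "\<exists>F. two_domain (n + 3) (m + 2) F"
proof -
  from f obtain x0 i where x0: "x0 \<in> cube n" "i < n" "0 < f x0" "f (flip i x0) < 0"
    by (auto simp: two_domain_def)
  from f have dep: "depends_below n f" and nz: "\<And>x. f x \<noteq> 0" and lap: "laplace n m f"
    and con: "pos_connected n f" "pos_connected n (\<lambda>x. - f x)"
    by (auto simp: two_domain_def)
  obtain g where g: "depends_below n g" "\<And>x. g x \<noteq> 0" "laplace n (m + 1) g"
    "0 < g x0" "0 < g (flip i x0)"
    using character_exists[OF x0(2) mn] by blast
  have ndep: "depends_below n (\<lambda>x. - f x)"
    using dep by (rule depends_below_uminus)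
  define F where "F = extend3 n (n + 1) (n + 2) f g"
  have "pos_connected (n + 3) (extend3 n (n + 2) (n + 1) (\<lambda>x. - f x) g)"
    using x0 g con dep nz
    by (intro pos_connected_extend3[of _ _ _ _ _ "flip i x0" x0 i]) (auto simp: ndep flip_in_cube)
  then have "pos_connected (n + 3) (\<lambda>x. - F x)"
    by (simp add: F_def minus_extend3)
  moreover have "pos_connected (n + 3) F"
    unfolding F_def using x0 g con dep nz
    by (intro pos_connected_extend3[of _ _ _ _ _ x0 "flip i x0" i]) (auto simp: flip_in_cube)
  moreover have "x0 \<in> cube (n + 3)" "F x0 = f x0" "F (flip i x0) = f (flip i x0)"
    using x0 by (auto simp: F_def extend3_def cube_def flip_def)
  moreover have "depends_below (n + 3) F"
    unfolding F_def using dep g by (auto intro: depends_below_extend3)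
  moreover have "laplace (n + 3) (m + 2) F"
    unfolding F_def by (rule laplace_extend3[OF dep g(1) lap g(3)])
  moreover have "F x \<noteq> 0" for x
    using nz g by (simp add: F_def extend3_def)
  ultimately show ?thesis
    using x0 unfolding two_domain_def by (metis trans_less_add1)
qed

section \<open>The 5-cube\<close>

text \<open>
  The gluing that raises the level by one, applied to two functions of level 2 on the 3-cube; here
  the sign classes of \<open>base_f\<close> are not both connected, so connectivity is checked by hand.
\<close>

definition base_f :: "(nat \<Rightarrow> bool) \<Rightarrow> real" where
  "base_f x = - (sg (x 0) * sg (x 1) + sg (x 0) * sg (x 2) + sg (x 1) * sg (x 2))"

text \<open>This is \<open>base_f\<close> composed with \<open>flip 0\<close>: it is -3 where bits 1
  and 2 agree and differ from bit 0, and 1 elsewhere.\<close>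

definition base_g :: "(nat \<Rightarrow> bool) \<Rightarrow> real" where
  "base_g x = sg (x 0) * sg (x 1) + sg (x 0) * sg (x 2) - sg (x 1) * sg (x 2)"

definition base5 :: "(nat \<Rightarrow> bool) \<Rightarrow> real" where
  "base5 = extend2 3 4 base_f base_g"

definition point5 :: "bool \<Rightarrow> bool \<Rightarrow> bool \<Rightarrow> bool \<Rightarrow> bool \<Rightarrow> nat \<Rightarrow> bool" where
  "point5 a b c d e = (\<lambda>_. False)(0 := a, 1 := b, 2 := c, 3 := d, 4 := e)"

lemma point5_exhaust: "x \<in> cube 5 \<Longrightarrow> x = point5 (x 0) (x 1) (x 2) (x 3) (x 4)"
proof
  fix i :: nat assume "x \<in> cube 5"
  moreover consider "i = 0" | "i = 1" | "i = 2" | "i = 3" | "i = 4" | "5 \<le> i"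
    by linarith
  ultimately show "x i = point5 (x 0) (x 1) (x 2) (x 3) (x 4) i"
    by cases (auto simp: point5_def cube_def)
qed

lemma base5_point5: "base5 (point5 a b c d e) = sg d *
    (if d = e then - (sg a * sg b + sg a * sg c + sg b * sg c)
     else sg a * sg b + sg a * sg c - sg b * sg c)"
  by (simp add: base5_def extend2_def base_f_def base_g_def point5_def)

text \<open>Of the 16 positive points, six form the hexagon in the layer
  \<open>d = e = False\<close>, six lie in the layer of \<open>base_g\<close>, and two in each of
  the other layers. All are led to one root on the hexagon.\<close>

lemma pos_connected_base5: "pos_connected 5 base5"
proof -
  let ?root = "point5 False False True False False"
  have upd: "(point5 a b c d e)(0 := v) = point5 v b c d e"
    "(point5 a b c d e)(1 := v) = point5 a v c d e"
    "(point5 a b c d e)(2 := v) = point5 a b v d e"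
    "(point5 a b c d e)(3 := v) = point5 a b c v e"
    "(point5 a b c d e)(4 := v) = point5 a b c d v" for a b c d e v
    by (auto simp: point5_def fun_eq_iff)
  have step0: "linked base5 (point5 a b c d e) ?root"
    if "linked base5 (point5 v b c d e) ?root" "0 < base5 (point5 a b c d e)" "0 < base5 (point5 v b c d e)"
    for a b c d e v
    using that by (metis upd(1) linked_update linked_trans)
  have step1: "linked base5 (point5 a b c d e) ?root"
    if "linked base5 (point5 a v c d e) ?root" "0 < base5 (point5 a b c d e)" "0 < base5 (point5 a v c d e)"
    for a b c d e v
    using that by (metis upd(2) linked_update linked_trans)
  have step2: "linked base5 (point5 a b c d e) ?root"
    if "linked base5 (point5 a b v d e) ?root" "0 < base5 (point5 a b c d e)" "0 < base5 (point5 a b v d e)"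
    for a b c d e v
    using that by (metis upd(3) linked_update linked_trans)
  have step3: "linked base5 (point5 a b c d e) ?root"
    if "linked base5 (point5 a b c v e) ?root" "0 < base5 (point5 a b c d e)" "0 < base5 (point5 a b c v e)"
    for a b c d e v
    using that by (metis upd(4) linked_update linked_trans)
  have step4: "linked base5 (point5 a b c d e) ?root"
    if "linked base5 (point5 a b c d v) ?root" "0 < base5 (point5 a b c d e)" "0 < base5 (point5 a b c d v)"
    for a b c d e v
    using that by (metis upd(5) linked_update linked_trans)
  \<comment> \<open>The rest of the hexagon is reached by two paths that leave the root in opposite
    directions.\<close>
  have r1: "linked base5 (point5 False True True False False) ?root"
    by (rule step1[OF rtranclp.rtrancl_refl]) (simp_all add: base5_point5)
  have r2: "linked base5 (point5 True False True False False) ?root"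
    by (rule step0[OF rtranclp.rtrancl_refl]) (simp_all add: base5_point5)
  have r3: "linked base5 (point5 False True False False False) ?root"
    by (rule step2[OF r1]) (simp_all add: base5_point5)
  have r4: "linked base5 (point5 True False False False False) ?root"
    by (rule step2[OF r2]) (simp_all add: base5_point5)
  have r5: "linked base5 (point5 True True False False False) ?root"
    by (rule step1[OF r4]) (simp_all add: base5_point5)
  have hexagon: "linked base5 (point5 a b c False False) ?root" if "\<not> (a = b \<and> b = c)" for a b c
    using that r1 r2 r3 r4 r5 by (cases a; cases b; cases c) auto
  have mixed: "linked base5 (point5 a b c False True) ?root" if "\<not> (a \<noteq> b \<and> b = c)" for a b c
  proof -
    have mixed': "linked base5 (point5 a b c False True) ?root" if "a = b" "b \<noteq> c" for a b c
      by (rule step4[OF hexagon[of a b c]])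
        (use that in \<open>auto simp: base5_point5 sg_def\<close>)
    show ?thesis
    proof (cases "b = c")
      case True
      with \<open>\<not> (a \<noteq> b \<and> b = c)\<close> have "a = b" "b \<noteq> (\<not> c)"
        by auto
      \<comment> \<open>At a constant point \<open>base_f\<close> is negative, so bit 4 cannot be
        cleared directly; bit 2 is changed first.\<close>
      then show ?thesis
        by (intro step2[OF mixed'[of a b "\<not> c"]])
          (use True in \<open>auto simp: base5_point5 sg_def\<close>)
    next
      case False
      then show ?thesis
        by (intro step4[OF hexagon[of a b c]])
          (auto simp: base5_point5 sg_def)
    qed
  qed
  have "linked base5 (point5 a b c d e) ?root" if pos: "0 < base5 (point5 a b c d e)" for a b c d e
  proof (cases d)
    case d: True
    show ?thesis
    proof (cases e)
      case True
      \<comment> \<open>The positive points of this layer have \<open>a = b\<close> and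
        \<open>b = c\<close>; \<open>base_g\<close> is positive there.\<close>
      with d pos have "linked base5 (point5 a b c True True) ?root"
        by (intro step3[OF mixed[of a b c]]) (auto simp: base5_point5 sg_def split: if_splits)
      with d True show ?thesis
        by simp
    next
      case False
      \<comment> \<open>The positive points of this layer have \<open>a \<noteq> b\<close> and
        \<open>b = c\<close>, so they lie over the hexagon.\<close>
      with d pos have "linked base5 (point5 a b c True False) ?root"
        by (intro step3[OF hexagon[of a b c]]) (auto simp: base5_point5 sg_def split: if_splits)
      with d False show ?thesis
        by simp
    qed
  next
    case False
    with pos show ?thesis
      using hexagon[of a b c] mixed[of a b c]
      by (cases e) (auto simp: base5_point5 sg_def split: if_splits)
  qed
  then show ?thesis
    by (intro pos_connectedI[of _ _ ?root]) (metis point5_exhaust)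
qed

lemma two_domain_base5: "two_domain 5 3 base5"
proof -
  have dep: "depends_below 3 base_f" "depends_below 3 base_g"
    by (simp_all add: depends_below_def base_f_def base_g_def)
  have lt3: "{..<3} = {0, 1, 2 :: nat}"
    by auto
  have lap: "laplace 3 2 base_f" "laplace 3 2 base_g"
    by (simp_all add: laplace_def base_f_def base_g_def flip_def lt3 algebra_simps)
  have nz: "base_f x \<noteq> 0" "base_g x \<noteq> 0" for x
    by (simp_all add: base_f_def base_g_def sg_def)
  have dep5: "depends_below 5 base5"
    unfolding base5_def using dep by (intro depends_below_extend2[of 3]) auto
  have lap5: "laplace 5 3 base5"
    using laplace_extend2[OF dep lap] by (simp add: base5_def)
  have nz5: "base5 x \<noteq> 0" for x
    using nz by (simp add: base5_def extend2_def)
  \<comment> \<open>The antipodal map of the 5-cube negates \<open>base5\<close>: products of two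
    signs are preserved and the outer factor \<open>sg (x 3)\<close> changes. It thus carries the
    positive class onto the negative one.\<close>
  define \<psi> where "\<psi> x = (\<lambda>i. if i < 5 then \<not> x i else x i)" for x :: "nat \<Rightarrow> bool"
  have odd: "- base5 (\<psi> x) = base5 x" for x
    by (simp add: base5_def extend2_def base_f_def base_g_def \<psi>_def)
  have \<psi>_\<psi>: "\<psi> (\<psi> x) = x" for x
    by (auto simp: \<psi>_def)
  have \<psi>_cube: "\<psi> x \<in> cube 5" if "x \<in> cube 5" for x
    using that by (auto simp: \<psi>_def cube_def)
  have \<psi>_flip: "\<psi> (flip i x) = flip i (\<psi> x)" for i x
    by (auto simp: \<psi>_def flip_def fun_eq_iff)
  have "pos_connected 5 (\<lambda>x. - base5 x)"
    unfolding pos_connected_def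
  proof (intro ballI impI)
    fix x y assume "x \<in> cube 5" "y \<in> cube 5" "0 < - base5 x" "0 < - base5 y"
    then have "linked base5 (\<psi> x) (\<psi> y)"
      using pos_connected_base5 odd[of "\<psi> x"] odd[of "\<psi> y"]
      by (simp add: pos_connected_def \<psi>_cube \<psi>_\<psi>)
    then have "linked (\<lambda>x. - base5 x) (\<psi> (\<psi> x)) (\<psi> (\<psi> y))"
      by (rule linked_map[rotated 2]) (simp_all add: odd \<psi>_flip)
    then show "linked (\<lambda>x. - base5 x) x y"
      by (simp add: \<psi>_\<psi>)
  qed
  moreover have "\<exists>x \<in> cube 5. \<exists>i<5. 0 < base5 x \<and> base5 (flip i x) < 0"
  proof (intro bexI exI conjI)
    show "0 < base5 (point5 False False True False False)"
      by (simp add: base5_point5)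
    have "flip 2 (point5 False False True False False) = point5 False False False False False"
      by (auto simp: flip_def point5_def fun_eq_iff)
    then show "base5 (flip 2 (point5 False False True False False)) < 0"
      by (simp add: base5_point5)
  qed (auto simp: cube_def point5_def)
  ultimately show ?thesis
    using dep5 lap5 nz5 pos_connected_base5 by (simp add: two_domain_def)
qed

lemma two_domain_odd: "1 \<le> k \<Longrightarrow> \<exists>f. two_domain (3 * k + 2) (2 * k + 1) f"
proof (induction k rule: dec_induct)
  case base
  have "two_domain (3 * 1 + 2) (2 * 1 + 1) base5"
    using two_domain_base5 by simp
  then show ?case by blast
next
  case (step k)
  then obtain f where "two_domain (3 * k + 2) (2 * k + 1) f"
    by blast
  then have "\<exists>F. two_domain (3 * k + 2 + 3) (2 * k + 1 + 2) F"
    \<comment> \<open>The required bound \<open>2 * k + 2 < 3 * k + 2\<close> amounts to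
      \<open>1 \<le> k\<close>.\<close>
    by (rule two_domain_extend3) (use step.hyps in simp)
  then show ?case
    by (simp add: algebra_simps)
qed

text \<open>A single gluing with two new bits, after those with three, changes the parity of the
  level.\<close>

lemma two_domain_even: "1 \<le> k \<Longrightarrow> \<exists>f. two_domain (3 * k + 4) (2 * k + 2) f"
proof -
  assume "1 \<le> k"
  then obtain f where "two_domain (3 * k + 2) (2 * k + 1) f"
    using two_domain_odd by blast
  then have "\<exists>F. two_domain (3 * k + 2 + 2) (2 * k + 1 + 1) F"
    by (rule two_domain_extend2) simp
  moreover have "3 * k + 2 + 2 = 3 * k + 4" "2 * k + 1 + 1 = 2 * k + 2"
    by simp_all
  ultimately show ?thesis
    by metis
qed

section \<open>Transfer to the Hamming graph\<close>

text \<open>Every induced subgraph inside \<open>S\<close> has its vertices in the connected one on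
  all of \<open>S\<close>, so a maximal one has the same vertices and, being induced, is the same
  graph.\<close>

lemma components_in_eq_singleton:
  assumes "wf_digraph G" and conn: "Digraph_Component.connected (G \<restriction> (verts G \<inter> S))"
  shows "components_in G S = {G \<restriction> (verts G \<inter> S)}"
proof -
  interpret wf_digraph G by fact
  let ?W = "verts G \<inter> S"
  have ind: "induced_subgraph (G \<restriction> ?W) G"
    by (rule induced_induce) blast
  have "H = G \<restriction> ?W" if H: "H \<in> components_in G S" for H
  proof -
    from H have ind_H: "induced_subgraph H G" and "verts H \<subseteq> S"
      and max: "\<And>H'. induced_subgraph H' G \<Longrightarrow> Digraph_Component.connected H' \<Longrightarrow>
        verts H' \<subseteq> S \<Longrightarrow> \<not> verts H \<subset> verts H'"
      unfolding components_in_def by blast+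
    have "\<not> verts H \<subset> ?W"
      using max[OF ind conn] by simp
    moreover note \<open>verts H \<subseteq> S\<close>
    moreover have "verts H \<subseteq> verts G"
      using ind_H by auto
    ultimately have "verts H = ?W"
      by blast
    with ind_H ind show ?thesis
      by (intro induced_eq_verts_imp_eq) simp_all
  qed
  moreover have "G \<restriction> ?W \<in> components_in G S"
    using ind conn by (auto simp: components_in_def)
  ultimately show ?thesis
    by blast
qed

text \<open>The guard \<open>i < n\<close> discards the value \<open>undefined\<close> that an
  extensional function takes outside its domain.\<close>

definition bits :: "nat \<Rightarrow> (nat \<Rightarrow> nat) \<Rightarrow> nat \<Rightarrow> bool" where
  "bits n x i \<longleftrightarrow> i < n \<and> x i = 1"

definition vertex :: "nat \<Rightarrow> (nat \<Rightarrow> bool) \<Rightarrow> nat \<Rightarrow> nat" where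
  "vertex n b = (\<lambda>i\<in>{..<n}. of_bool (b i))"

lemma bits_in_cube: "bits n x \<in> cube n"
  by (simp add: bits_def cube_def)

lemma vertex_in_verts: "vertex n b \<in> pverts (hamming_graph n 2)"
  by (auto simp: vertex_def hamming_graph_def)

lemma vertex_bits: "x \<in> pverts (hamming_graph n 2) \<Longrightarrow> vertex n (bits n x) = x"
  by (rule ext) (force simp: vertex_def bits_def hamming_graph_def PiE_def extensional_def Pi_def)

lemma depends_below_bits_vertex: "depends_below n f \<Longrightarrow> f (bits n (vertex n b)) = f b"
  unfolding depends_below_def by (auto simp: bits_def vertex_def)

lemma vertex_flip_adj:
  assumes "i < n"
  shows "(vertex n b, vertex n (flip i b)) \<in> parcs (hamming_graph n 2)"
proof -
  have "{j \<in> {..<n}. vertex n b j \<noteq> vertex n (flip i b) j} = {i}"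
    using assms by (auto simp: vertex_def flip_def split: if_splits)
  then show ?thesis
    using vertex_in_verts[of n b] vertex_in_verts[of n "flip i b"] by (simp add: hamming_graph_def)
qed

text \<open>For two letters, a differing coordinate has only one other value, so the coordinate
  determines the neighbour.\<close>

lemma neighbours_vertex:
  "neighbours (hamming_graph n 2) (vertex n b) = (\<lambda>i. vertex n (flip i b)) ` {..<n}"
proof (intro equalityI subsetI)
  fix y assume "y \<in> neighbours (hamming_graph n 2) (vertex n b)"
  then have y: "y \<in> {..<n} \<rightarrow>\<^sub>E {..<2}" and "card {j \<in> {..<n}. vertex n b j \<noteq> y j} = 1"
    by (auto simp: neighbours_def hamming_graph_def)
  then obtain i where i: "{j \<in> {..<n}. vertex n b j \<noteq> y j} = {i}"
    using card_1_singletonE by blast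
  have "y j = vertex n (flip i b) j" for j
  proof (cases "j < n")
    case True
    with y have "y j < 2"
      by auto
    have "vertex n b j \<noteq> y j \<longleftrightarrow> j = i"
      using True i by blast
    with True \<open>y j < 2\<close> show ?thesis
      by (cases "b j") (auto simp: vertex_def flip_def less_2_cases_iff)
  next
    case False
    with y show ?thesis
      by (auto simp: vertex_def PiE_def extensional_def)
  qed
  then have "y = vertex n (flip i b)" by blast
  moreover have "i < n"
    using i by auto
  ultimately show "y \<in> (\<lambda>i. vertex n (flip i b)) ` {..<n}"
    by blast
qed (use vertex_flip_adj in \<open>auto simp: neighbours_def\<close>)

lemma inj_on_vertex_flip: "inj_on (\<lambda>i. vertex n (flip i b)) {..<n}"
proof (rule inj_onI)
  fix i j assume "i \<in> {..<n}" "j \<in> {..<n}" "vertex n (flip i b) = vertex n (flip j b)"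
  then have "vertex n (flip i b) i = vertex n (flip j b) i" "i < n"
    by auto
  then show "i = j"
    by (cases "b i") (auto simp: vertex_def flip_def split: if_splits)
qed

lemma eigenfunction_bits:
  assumes "depends_below n f" "laplace n m f" "\<And>x. f x \<noteq> 0"
  shows "eigenfunction (hamming_graph n 2) (2 * real m) (\<lambda>x. f (bits n x))"
  unfolding eigenfunction_def with_proj_simps
proof (intro conjI ballI)
  show "\<exists>x \<in> pverts (hamming_graph n 2). f (bits n x) \<noteq> 0"
    using assms vertex_in_verts by blast
  fix x assume x: "x \<in> pverts (hamming_graph n 2)"
  have "(\<Sum>y \<in> neighbours (hamming_graph n 2) (vertex n (bits n x)). f (bits n x) - f (bits n y)) =
      (\<Sum>i<n. f (bits n x) - f (flip i (bits n x)))"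
    by (simp add: neighbours_vertex sum.reindex[OF inj_on_vertex_flip]
        depends_below_bits_vertex[OF assms(1)])
  also have "\<dots> = 2 * real m * f (bits n x)"
    using assms(2) by (simp only: laplace_def)
  finally show "2 * real m * f (bits n x) =
      (\<Sum>y \<in> neighbours (hamming_graph n 2) x. f (bits n x) - f (bits n y))"
    by (simp only: vertex_bits[OF x])
qed

lemma linked_imp_reachable:
  fixes n :: nat
  defines "G \<equiv> with_proj (hamming_graph n 2)"
  assumes dep: "depends_below n f" and "linked f b c" and "0 < f b"
  shows "vertex n b \<rightarrow>\<^sup>*\<^bsub>G \<restriction> (verts G \<inter> {x. 0 < f (bits n x)})\<^esub> vertex n c"
  using \<open>linked f b c\<close>
proof (induction rule: rtranclp_induct)
  interpret pair_graph "hamming_graph n 2"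
    by (rule pair_graph_hamming_graph)
  let ?H = "G \<restriction> (verts G \<inter> {x. 0 < f (bits n x)})"
  interpret H: wf_digraph ?H
    unfolding G_def by (rule wellformed_induce_subgraph)
  have vert: "vertex n b \<in> verts ?H" if "0 < f b" for b
    using that by (simp add: G_def vertex_in_verts depends_below_bits_vertex[OF dep])
  {
    case base
    show ?case
      using vert[OF \<open>0 < f b\<close>] by blast
  next
    case (step c d)
    then obtain i where d: "d = flip i c" and pos: "0 < f c" "0 < f d"
      by (auto simp: pos_step_def)
    show ?case
    proof (cases "i < n")
      case True
      then have "vertex n c \<rightarrow>\<^bsub>?H\<^esub> vertex n d"
        using vert[OF pos(1)] vert[OF pos(2)] vertex_flip_adj[of i n c] d
        by (force simp: G_def arcs_ends_conv induce_subgraph_def)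
      with step.IH show ?thesis
        by (rule H.reachable_adj_trans)
    next
      case False
      \<comment> \<open>A flip beyond the dimension is invisible to \<open>vertex n\<close>, so the
        walk in the graph pauses.\<close>
      then have "vertex n d = vertex n c"
        by (auto simp: d vertex_def flip_def)
      with step.IH show ?thesis
        by simp
    qed
  }
qed

lemma nodal_domains_bits:
  fixes n :: nat
  defines "G \<equiv> with_proj (hamming_graph n 2)"
  assumes dep: "depends_below n f" and con: "pos_connected n f" and x: "0 < f x"
  shows "components_in G {x. 0 < f (bits n x)} = {G \<restriction> (verts G \<inter> {x. 0 < f (bits n x)})}"
    (is "_ = {?H}")
proof (rule components_in_eq_singleton)
  interpret pair_graph "hamming_graph n 2"
    by (rule pair_graph_hamming_graph)
  show "wf_digraph G"
    unfolding G_def by (rule wf_digraph)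
  interpret H: wf_digraph ?H
    unfolding G_def by (rule wellformed_induce_subgraph)
  \<comment> \<open>Connectedness includes nonemptiness, for which the positive point
    \<open>x\<close> is the witness.\<close>
  have "vertex n x \<in> verts ?H"
    using x by (simp add: G_def vertex_in_verts depends_below_bits_vertex[OF dep])
  moreover have "u \<rightarrow>\<^sup>*\<^bsub>?H\<^esub> v" if "u \<in> verts ?H" "v \<in> verts ?H" for u v
  proof -
    from that have pos: "0 < f (bits n u)" "0 < f (bits n v)"
      by simp_all
    then have "linked f (bits n u) (bits n v)"
      using con bits_in_cube unfolding pos_connected_def by blast
    then have "vertex n (bits n u) \<rightarrow>\<^sup>*\<^bsub>?H\<^esub> vertex n (bits n v)"
      using dep pos(1) unfolding G_def by (intro linked_imp_reachable)
    moreover have "u \<in> pverts (hamming_graph n 2)" "v \<in> pverts (hamming_graph n 2)"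
      using that by (simp_all add: G_def)
    ultimately show ?thesis
      by (simp only: vertex_bits)
  qed
  ultimately show "Digraph_Component.connected ?H"
    unfolding Digraph_Component.connected_def strongly_connected_def with_proj_simps
      pverts_mk_symmetric
    using H.reachable_mk_symmetricI by blast
qed

lemma two_domain_imp_eigenfunction_SND:
  assumes "two_domain n m f"
  shows "\<exists>h. eigenfunction (hamming_graph n 2) (2 * real m) h \<and> SND (hamming_graph n 2) h = 2"
proof (intro exI conjI)
  let ?G = "with_proj (hamming_graph n 2)"
  let ?P = "?G \<restriction> (verts ?G \<inter> {x. 0 < f (bits n x)})"
  let ?N = "?G \<restriction> (verts ?G \<inter> {x. 0 < - f (bits n x)})"
  from assms obtain x i where dep: "depends_below n f" and nz: "\<And>x. f x \<noteq> 0"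
    and lap: "laplace n m f" and con: "pos_connected n f" "pos_connected n (\<lambda>x. - f x)"
    and x: "0 < f x" "f (flip i x) < 0"
    unfolding two_domain_def by blast
  show "eigenfunction ?G (2 * real m) (\<lambda>x. f (bits n x))"
    using dep lap nz by (rule eigenfunction_bits)
  have P: "positive_strong_nodal_domains ?G (\<lambda>x. f (bits n x)) = {?P}"
    unfolding positive_strong_nodal_domains_def using dep con(1) x(1) by (rule nodal_domains_bits)
  have "components_in ?G {x. 0 < - f (bits n x)} = {?N}"
    using x(2) by (intro nodal_domains_bits[OF depends_below_uminus[OF dep] con(2)]) simp
  then have N: "negative_strong_nodal_domains ?G (\<lambda>x. f (bits n x)) = {?N}"
    by (simp add: negative_strong_nodal_domains_def)
  \<comment> \<open>The two domains must be distinct for the union of the two singletons to have two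
    elements.\<close>
  have "vertex n x \<in> verts ?P" "vertex n x \<notin> verts ?N"
    using x by (simp_all add: vertex_in_verts depends_below_bits_vertex[OF dep])
  then have "?P \<noteq> ?N"
    using arg_cong[of ?P ?N verts] by blast
  then show "SND ?G (\<lambda>x. f (bits n x)) = 2"
    by (simp add: SND_def P N)
qed

theorem theorem5:
  shows "(\<forall>k n :: nat. k \<ge> 1 \<and> n \<ge> 3 * k + 2 \<longrightarrow>
           (\<exists>f. eigenfunction (hamming_graph n 2) (2 * (2 * real k + 1)) f \<and>
                SND (hamming_graph n 2) f = 2)) \<and>
         (\<forall>k n :: nat. k \<ge> 1 \<and> n \<ge> 3 * k + 4 \<longrightarrow>
           (\<exists>f. eigenfunction (hamming_graph n 2) (2 * (2 * real k + 2)) f \<and>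
                SND (hamming_graph n 2) f = 2))"
proof (intro conjI allI impI)
  fix k n :: nat
  assume kn: "1 \<le> k \<and> 3 * k + 2 \<le> n"
  with two_domain_odd[of k] obtain f where "two_domain (3 * k + 2) (2 * k + 1) f"
    by blast
  with kn have "two_domain n (2 * k + 1) f"
    using two_domain_mono by blast
  then show "\<exists>f. eigenfunction (hamming_graph n 2) (2 * (2 * real k + 1)) f \<and>
      SND (hamming_graph n 2) f = 2"
    using two_domain_imp_eigenfunction_SND[of n "2 * k + 1" f] by (simp add: add.commute)
next
  fix k n :: nat
  assume kn: "1 \<le> k \<and> 3 * k + 4 \<le> n"
  with two_domain_even[of k] obtain f where "two_domain (3 * k + 4) (2 * k + 2) f"
    by blast
  with kn have "two_domain n (2 * k + 2) f"
    using two_domain_mono by blast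
  then show "\<exists>f. eigenfunction (hamming_graph n 2) (2 * (2 * real k + 2)) f \<and>
      SND (hamming_graph n 2) f = 2"
    using two_domain_imp_eigenfunction_SND[of n "2 * k + 2" f] by (simp add: add.commute)
qed

end
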